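(* Let $\eta \ge \tfrac12$ and $T>0$. Then $v\mapsto x_v(T)$ is strictly increasing (on the set of $v\in\mathbb{R}$ for which $y_v$ is finite on $[0,T]$), and therefore for every $\bar\theta\in[0,1]$ the boundary value problem $$ \begin{cases} \frac{d^2}{dt^2}y + y-\frac{1}{2}y^3-3 \eta |y|y-4\eta^2y=0 \quad\text{on } [0,T], \\ \frac{1}{2}y(T)|y(T)|+2 \eta y(T)+\frac{d}{dt} y(T)=2\bar{\theta}-1,\\ y(0) =0 \end{cases} $$ has a unique solution $y:[0,T]\to\mathbb{R}$.
   Context: For $\eta\ge 0$ and $v\in\mathbb{R}$, $y_v(\cdot)$ denotes the unique solution (on its maximal interval of existence in $t\ge 0$) of the initial value problem $$\frac{d^2}{dt^2}y + y-\frac{1}{2}y^3-3 \eta |y|y-4\eta^2y=0,\qquad y(0)=0,\quad \frac{d}{dt}y(0)=v,$$ and $$x_v(t):=\frac12 y_v(t)|y_v(t)|+2\eta y_v(t)+\frac{d}{dt}y_v(t).$$ Thus solutions of the boundary value problem in the claim correspond to those $v$ with $y_v$ finite on $[0,T]$ and $x_v(T)=2\bar\theta-1$. Background: the boundary value problem is the time reversal of the two-state mean field game system $\dot x = y-x|y|-2\eta x$, $-\dot y = x-\frac12 y|y|-2\eta y$, $y(T)=0$, $x(0)=2\bar\theta-1$, written as a single equation for $y$; here $x=2\theta-1$ with $\theta$ the fraction of players in state $0$, and $y=u(t,1)-u(t,0)$ is the difference of the value functions. *)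

theory Defs
  imports "HOL-Analysis.Analysis"
begin

text \<open>
  \<open>z\<close> is the derivative of \<open>y\<close>; derivatives are taken within \<open>S\<close>, hence one-sided at
  end points belonging to \<open>S\<close>.
\<close>

definition solves_ode :: "real \<Rightarrow> real set \<Rightarrow> (real \<Rightarrow> real) \<Rightarrow> (real \<Rightarrow> real) \<Rightarrow> bool" where
  "solves_ode \<eta> S y z \<longleftrightarrow>
     (\<forall>t\<in>S. (y has_real_derivative z t) (at t within S) \<and>
        (\<exists>w. (z has_real_derivative w) (at t within S) \<and>
             w + y t - 1/2 * y t ^ 3 - 3 * \<eta> * \<bar>y t\<bar> * y t - 4 * \<eta>\<^sup>2 * y t = 0))"

definition solves_ivp :: "real \<Rightarrow> real \<Rightarrow> real set \<Rightarrow> (real \<Rightarrow> real) \<Rightarrow> bool" where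
  "solves_ivp \<eta> v S y \<longleftrightarrow> (\<exists>z. solves_ode \<eta> S y z \<and> y 0 = 0 \<and> z 0 = v)"

text \<open>
  The maximal interval of existence in \<open>t \<ge> 0\<close> is the union of all intervals \<open>[0, t]\<close> that carry
  a solution, and \<open>y_sol \<eta> v\<close> is the function on it obtained by gluing these solutions. (The
  description is unique because the nonlinearity is locally Lipschitz.) Outside
  \<open>existence_ivl \<eta> v\<close> the value of \<open>y_sol \<eta> v\<close> is unspecified.
\<close>

definition existence_ivl :: "real \<Rightarrow> real \<Rightarrow> real set" where
  "existence_ivl \<eta> v = {t. 0 \<le> t \<and> (\<exists>y. solves_ivp \<eta> v {0..t} y)}"

definition y_sol :: "real \<Rightarrow> real \<Rightarrow> real \<Rightarrow> real" where
  "y_sol \<eta> v t = (THE a. \<exists>y. solves_ivp \<eta> v {0..t} y \<and> y t = a)"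

definition x_sol :: "real \<Rightarrow> real \<Rightarrow> real \<Rightarrow> real" where
  "x_sol \<eta> v t = 1/2 * y_sol \<eta> v t * \<bar>y_sol \<eta> v t\<bar> + 2 * \<eta> * y_sol \<eta> v t
     + vector_derivative (y_sol \<eta> v) (at t within existence_ivl \<eta> v)"

definition solves_bvp :: "real \<Rightarrow> real \<Rightarrow> real \<Rightarrow> (real \<Rightarrow> real) \<Rightarrow> bool" where
  "solves_bvp \<eta> T \<theta> y \<longleftrightarrow>
     (\<exists>z. solves_ode \<eta> {0..T} y z \<and>
          1/2 * y T * \<bar>y T\<bar> + 2 * \<eta> * y T + z T = 2 * \<theta> - 1 \<and>
          y 0 = 0)"

end

theory Submission
  imports Defs
begin

text \<open>
  For \<open>\<eta> \<ge> 1/2\<close> the equation is \<open>y'' = g(y)\<close> with \<open>g\<close> nondecreasing. The difference \<open>u\<close> of two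
  solutions with \<open>u(0) = 0\<close> satisfies \<open>(u u')' \<ge> 0\<close>, so \<open>u u' \<ge> 0\<close> and \<open>u\<^sup>2\<close> is nondecreasing. As
  the boundary operator is \<open>h(y) + y'\<close> with \<open>h\<close> strictly increasing, this gives both monotonicity in
  the initial speed and uniqueness for the boundary value problem. Existence is obtained by
  quadrature: the conserved energy is \<open>y'\<^sup>2 - (h(y)\<^sup>2 - y\<^sup>2)\<close>, so a solution is the inverse of an
  explicit travel time integral, and the terminal height is found with the intermediate value
  theorem.
\<close>

section \<open>Comparison and uniqueness\<close>

text \<open>The \<open>g\<close> of the overview: the equation solved for the second
  derivative.\<close>

definition force :: "real \<Rightarrow> real \<Rightarrow> real" where
  "force \<eta> y = (4 * \<eta>\<^sup>2 - 1) * y + 3 * \<eta> * (\<bar>y\<bar> * y) + 1/2 * y ^ 3"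

text \<open>The \<open>h\<close> of the overview: the boundary operator without its derivative
  term.\<close>

definition flux :: "real \<Rightarrow> real \<Rightarrow> real" where
  "flux \<eta> y = 1/2 * y * \<bar>y\<bar> + 2 * \<eta> * y"

lemma solves_ode_force:
  "solves_ode \<eta> S y z \<longleftrightarrow>
     (\<forall>t\<in>S. (y has_real_derivative z t) (at t within S) \<and>
            (z has_real_derivative force \<eta> (y t)) (at t within S))"
proof -
  have "w + y t - 1/2 * y t ^ 3 - 3 * \<eta> * \<bar>y t\<bar> * y t - 4 * \<eta>\<^sup>2 * y t = 0 \<longleftrightarrow> w = force \<eta> (y t)"
    for w t
    by (auto simp: force_def algebra_simps)
  then show ?thesis
    unfolding solves_ode_def by simp
qed

lemma solves_odeI:
  assumes "\<And>t. t \<in> S \<Longrightarrow> (y has_real_derivative z t) (at t within S)"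
    and "\<And>t. t \<in> S \<Longrightarrow> (z has_real_derivative force \<eta> (y t)) (at t within S)"
  shows "solves_ode \<eta> S y z"
  using assms by (simp add: solves_ode_force)

lemma solves_odeD:
  assumes "solves_ode \<eta> S y z" and "t \<in> S"
  shows "(y has_real_derivative z t) (at t within S)"
    and "(z has_real_derivative force \<eta> (y t)) (at t within S)"
  using assms by (simp_all add: solves_ode_force)

lemma solves_ode_subset:
  assumes "solves_ode \<eta> S y z" and "R \<subseteq> S"
  shows "solves_ode \<eta> R y z"
  using assms by (intro solves_odeI) (blast intro: solves_odeD DERIV_subset)+

text \<open>Derivatives within \<open>S\<close> see only values on \<open>S\<close>; this permits
  restricting a solution to \<open>{0..T}\<close>.\<close>

lemma solves_ode_cong:
  assumes "solves_ode \<eta> S y z" and "\<And>t. t \<in> S \<Longrightarrow> x t = y t"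
  shows "solves_ode \<eta> S x z"
proof (rule solves_odeI)
  fix t assume t: "t \<in> S"
  show "(x has_real_derivative z t) (at t within S)"
    by (rule has_field_derivative_transform_within[OF solves_odeD(1)[OF assms(1) t] zero_less_one t])
      (simp add: assms(2))
  show "(z has_real_derivative force \<eta> (x t)) (at t within S)"
    using solves_odeD(2)[OF assms(1) t] assms(2)[OF t] by simp
qed

section \<open>Symmetry, monotonicity and Lipschitz bounds of the nonlinearities\<close>

lemma force_minus [simp]: "force \<eta> (- y) = - force \<eta> y"
  by (simp add: force_def)

lemma flux_minus [simp]: "flux \<eta> (- y) = - flux \<eta> y"
  by (simp add: flux_def)

lemma flux_0 [simp]: "flux \<eta> 0 = 0"
  by (simp add: flux_def)

lemma solves_ode_minus:
  assumes "solves_ode \<eta> S y z"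
  shows "solves_ode \<eta> S (\<lambda>t. - y t) (\<lambda>t. - z t)"
  by (rule solves_odeI) (auto intro!: derivative_eq_intros solves_odeD[OF assms])

lemma continuous_on_flux: "continuous_on A (flux \<eta>)"
  unfolding flux_def by (intro continuous_intros)

lemma mult_abs_mono:
  fixes a b :: real
  assumes "a \<le> b"
  shows "\<bar>a\<bar> * a \<le> \<bar>b\<bar> * b"
proof (cases "0 \<le> a \<or> b \<le> 0")
  case True
  then show ?thesis
    using assms mult_mono[of a b a b] mult_mono[of "-b" "-a" "-b" "-a"] by auto
next
  case False
  then have "\<bar>a\<bar> * a \<le> 0" "0 \<le> \<bar>b\<bar> * b"
    by (auto intro: mult_nonneg_nonpos)
  then show ?thesis by linarith
qed

lemma flux_strict_mono:
  assumes "\<eta> > 0" "a < b"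
  shows "flux \<eta> a < flux \<eta> b"
proof -
  have "1/2 * a * \<bar>a\<bar> \<le> 1/2 * b * \<bar>b\<bar>"
    using mult_abs_mono[of a b] assms by (simp add: mult.commute)
  moreover have "2 * \<eta> * a < 2 * \<eta> * b"
    using assms by simp
  ultimately show ?thesis
    unfolding flux_def by linarith
qed

text \<open>The bound on \<open>\<eta>\<close> makes the linear coefficient
  \<open>4 * \<eta>\<^sup>2 - 1\<close> nonnegative; the quadratic and cubic terms increase as
  well.\<close>

lemma force_mono:
  assumes "\<eta> \<ge> 1/2" "a \<le> b"
  shows "force \<eta> a \<le> force \<eta> b"
proof -
  have "(1/2)\<^sup>2 \<le> \<eta>\<^sup>2"
    using assms by (intro power_mono) auto
  then have "0 \<le> 4 * \<eta>\<^sup>2 - 1"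
    by (simp add: power2_eq_square)
  moreover have "a ^ 3 \<le> b ^ 3"
    using assms by (intro power_mono_odd) auto
  ultimately show ?thesis
    unfolding force_def using assms mult_abs_mono[of a b]
    by (intro add_mono mult_left_mono) auto
qed

text \<open>On \<open>[-M, M]\<close> the function \<open>\<bar>s\<bar> * s\<close> has Lipschitz
  constant \<open>2 * M\<close> and the cube \<open>3 * M\<^sup>2\<close>, weighted by
  \<open>3 * \<eta>\<close> and \<open>1/2\<close>. The bound feeds the Gronwall argument for the
  initial value problem.\<close>

lemma force_lipschitz:
  assumes "\<eta> \<ge> 0" and a: "\<bar>a\<bar> \<le> M" and b: "\<bar>b\<bar> \<le> M"
  shows "\<bar>force \<eta> a - force \<eta> b\<bar> \<le> (\<bar>4 * \<eta>\<^sup>2 - 1\<bar> + 6 * \<eta> * M + 3/2 * M\<^sup>2) * \<bar>a - b\<bar>"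
proof -
  have M: "0 \<le> M" using a by linarith
  have "\<bar>\<bar>a\<bar> * a - \<bar>b\<bar> * b\<bar> = \<bar>\<bar>a\<bar> * (a - b) + (\<bar>a\<bar> - \<bar>b\<bar>) * b\<bar>"
    by (simp add: algebra_simps)
  also have "\<dots> \<le> \<bar>a\<bar> * \<bar>a - b\<bar> + \<bar>\<bar>a\<bar> - \<bar>b\<bar>\<bar> * \<bar>b\<bar>"
    by (metis abs_triangle_ineq abs_mult abs_abs)
  also have "\<dots> \<le> M * \<bar>a - b\<bar> + \<bar>a - b\<bar> * M"
    using a b M by (intro add_mono mult_mono) auto
  finally have 1: "\<bar>\<bar>a\<bar> * a - \<bar>b\<bar> * b\<bar> \<le> 2 * M * \<bar>a - b\<bar>"
    by simp
  have "\<bar>a ^ 3 - b ^ 3\<bar> = \<bar>a * a + a * b + b * b\<bar> * \<bar>a - b\<bar>"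
    unfolding abs_mult[symmetric] by (simp add: algebra_simps power3_eq_cube)
  also have "\<dots> \<le> (M * M + M * M + M * M) * \<bar>a - b\<bar>"
  proof (intro mult_right_mono)
    have "\<bar>p * q\<bar> \<le> M * M" if "\<bar>p\<bar> \<le> M" "\<bar>q\<bar> \<le> M" for p q
      unfolding abs_mult using that M by (intro mult_mono) auto
    from this[OF a a] this[OF a b] this[OF b b] show "\<bar>a * a + a * b + b * b\<bar> \<le> M * M + M * M + M * M"
      by linarith
  qed auto
  finally have 2: "\<bar>a ^ 3 - b ^ 3\<bar> \<le> 3 * M\<^sup>2 * \<bar>a - b\<bar>"
    by (simp add: power2_eq_square)
  have "force \<eta> a - force \<eta> b = (4 * \<eta>\<^sup>2 - 1) * (a - b) + 3 * \<eta> * (\<bar>a\<bar> * a - \<bar>b\<bar> * b)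
      + 1/2 * (a ^ 3 - b ^ 3)"
    unfolding force_def by (simp add: algebra_simps)
  also have "\<bar>\<dots>\<bar> \<le> \<bar>4 * \<eta>\<^sup>2 - 1\<bar> * \<bar>a - b\<bar> + 3 * \<eta> * \<bar>\<bar>a\<bar> * a - \<bar>b\<bar> * b\<bar>
      + 1/2 * \<bar>a ^ 3 - b ^ 3\<bar>"
    using assms(1)
    by (intro order_trans[OF abs_triangle_ineq] add_mono) (auto simp: abs_mult)
  also have "\<dots> \<le> \<bar>4 * \<eta>\<^sup>2 - 1\<bar> * \<bar>a - b\<bar> + 3 * \<eta> * (2 * M * \<bar>a - b\<bar>)
      + 1/2 * (3 * M\<^sup>2 * \<bar>a - b\<bar>)"
    using 1 2 assms(1) by (intro add_mono mult_left_mono) auto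
  finally show ?thesis
    by (simp add: algebra_simps)
qed

text \<open>Derivatives are one-sided at \<open>a\<close> and \<open>b\<close>: the sign is used at
  interior points only, and continuity covers the end points.\<close>

lemma deriv_within_nonneg_imp_nondecreasing:
  fixes f :: "real \<Rightarrow> real"
  assumes "\<And>t. t \<in> {a..b} \<Longrightarrow> (f has_real_derivative f' t) (at t within {a..b})"
    and "\<And>t. t \<in> {a..b} \<Longrightarrow> f' t \<ge> 0"
    and "a \<le> s" "s \<le> t" "t \<le> b"
  shows "f s \<le> f t"
proof (rule DERIV_nonneg_imp_increasing_open[OF \<open>s \<le> t\<close>])
  fix x assume x: "s < x" "x < t"
  then have "x \<in> {a..b}" "at x within {a..b} = at x"
    using assms by (auto intro!: at_within_Icc_at)
  then show "\<exists>y. DERIV f x :> y \<and> 0 \<le> y"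
    using assms(1)[of x] assms(2)[of x] by auto
next
  have "continuous_on {a..b} f"
    using assms(1) by (rule DERIV_continuous_on)
  then show "continuous_on {s..t} f"
    by (rule continuous_on_subset) (use assms in auto)
qed

section \<open>Two solutions with a common initial value\<close>

context
  fixes \<eta> T :: real and y1 z1 y2 z2 :: "real \<Rightarrow> real"
  assumes \<eta>: "\<eta> \<ge> 1/2"
    and ode1: "solves_ode \<eta> {0..T} y1 z1" and ode2: "solves_ode \<eta> {0..T} y2 z2"
    and init: "y1 0 = y2 0"
begin

text \<open>With \<open>u = y2 - y1\<close>, the derivative of \<open>u u'\<close> is
  \<open>u'^2\<close> plus the difference of forces times \<open>u\<close>; the latter is
  nonnegative since \<open>force\<close> is monotone. By \<open>init\<close>, \<open>u u'\<close>
  starts at 0.\<close>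

lemma diff_times_deriv_nonneg:
  assumes "t \<in> {0..T}"
  shows "0 \<le> (y2 t - y1 t) * (z2 t - z1 t)"
proof -
  let ?f = "\<lambda>t. (y2 t - y1 t) * (z2 t - z1 t)"
  let ?f' = "\<lambda>t. (z2 t - z1 t) * (z2 t - z1 t)
    + (force \<eta> (y2 t) - force \<eta> (y1 t)) * (y2 t - y1 t)"
  have "?f 0 \<le> ?f t"
  proof (rule deriv_within_nonneg_imp_nondecreasing[of 0 T ?f ?f'])
    fix s assume s: "s \<in> {0..T}"
    show "(?f has_real_derivative ?f' s) (at s within {0..T})"
      by (auto intro!: derivative_eq_intros solves_odeD[OF ode1 s] solves_odeD[OF ode2 s])
    have "0 \<le> (force \<eta> (y2 s) - force \<eta> (y1 s)) * (y2 s - y1 s)"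
      using force_mono[OF \<eta>, of "y1 s" "y2 s"] force_mono[OF \<eta>, of "y2 s" "y1 s"]
      by (cases "y1 s \<le> y2 s") (auto intro: mult_nonneg_nonneg mult_nonpos_nonpos)
    then show "0 \<le> ?f' s" by simp
  qed (use assms in auto)
  then show ?thesis using init by simp
qed

lemma diff_square_mono:
  assumes "0 \<le> s" "s \<le> t" "t \<le> T"
  shows "(y2 s - y1 s)\<^sup>2 \<le> (y2 t - y1 t)\<^sup>2"
proof (rule deriv_within_nonneg_imp_nondecreasing
    [of 0 T "\<lambda>t. (y2 t - y1 t)\<^sup>2" "\<lambda>t. 2 * ((y2 t - y1 t) * (z2 t - z1 t))"])
  fix s assume s: "s \<in> {0..T}"
  show "((\<lambda>s. (y2 s - y1 s)\<^sup>2) has_real_derivative 2 * ((y2 s - y1 s) * (z2 s - z1 s)))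
      (at s within {0..T})"
    by (auto intro!: derivative_eq_intros solves_odeD[OF ode1 s] solves_odeD[OF ode2 s]
        simp: algebra_simps)
  show "0 \<le> 2 * ((y2 s - y1 s) * (z2 s - z1 s))"
    using diff_times_deriv_nonneg[OF s] by simp
qed (use assms in auto)

text \<open>Equal boundary data express \<open>u'(T)\<close> as a difference of fluxes whose sign is
  opposite to that of a nonzero \<open>u(T)\<close>, against \<open>u u' \<ge> 0\<close>. So
  \<open>u(T) = 0\<close>, and monotonicity of \<open>u^2\<close> gives \<open>u = 0\<close>
  throughout.\<close>

lemma bvp_solution_unique:
  assumes "flux \<eta> (y1 T) + z1 T = flux \<eta> (y2 T) + z2 T" and t: "t \<in> {0..T}"
  shows "y1 t = y2 t"
proof -
  have T: "T \<in> {0..T}" using t by auto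
  have e: "z2 T - z1 T = flux \<eta> (y1 T) - flux \<eta> (y2 T)"
    using assms(1) by simp
  have "y1 T = y2 T"
  proof (rule ccontr)
    assume "y1 T \<noteq> y2 T"
    then have "(y2 T - y1 T) * (flux \<eta> (y1 T) - flux \<eta> (y2 T)) < 0"
      using flux_strict_mono[of \<eta> "y1 T" "y2 T"] flux_strict_mono[of \<eta> "y2 T" "y1 T"] \<eta>
      by (cases "y1 T < y2 T") (auto intro: mult_pos_neg mult_neg_pos)
    then show False using diff_times_deriv_nonneg[OF T] e by simp
  qed
  then have "(y2 t - y1 t)\<^sup>2 \<le> 0"
    using diff_square_mono[of t T] t by simp
  then show ?thesis by simp
qed

text \<open>A larger initial speed makes \<open>u = y2 - y1\<close> positive right after 0, and
  monotonicity of \<open>u^2\<close> forbids a return to 0. Hence \<open>u(T) > 0\<close>, and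
  \<open>u u' \<ge> 0\<close> yields \<open>u'(T) \<ge> 0\<close>.\<close>

lemma terminal_value_less:
  assumes "0 < T" and "z1 0 < z2 0"
  shows "flux \<eta> (y1 T) + z1 T < flux \<eta> (y2 T) + z2 T"
proof -
  let ?u = "\<lambda>t. y2 t - y1 t"
  have du: "(?u has_real_derivative z2 t - z1 t) (at t within {0..T})" if "t \<in> {0..T}" for t
    by (intro derivative_intros solves_odeD[OF ode1 that] solves_odeD[OF ode2 that])
  have "\<exists>d>0. \<forall>h>0. 0 + h \<in> {0..T} \<longrightarrow> h < d \<longrightarrow> ?u 0 < ?u (0 + h)"
    by (rule has_real_derivative_pos_inc_right[OF du]) (use assms in auto)
  then obtain d where d: "d > 0" "\<And>h. h > 0 \<Longrightarrow> h \<le> T \<Longrightarrow> h < d \<Longrightarrow> ?u 0 < ?u h"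
    by auto
  \<comment> \<open>Halving keeps \<open>s\<close> strictly below \<open>d\<close>; the minimum
    keeps it inside \<open>{0..T}\<close>.\<close>
  define s where "s = min (d/2) T"
  have s: "0 < s" "s \<le> T" "?u s > 0"
    using d(1) assms d(2)[of s] init unfolding s_def by (auto simp: min_def split: if_splits)
  have cont: "continuous_on {s..T} ?u"
    using du by (rule continuous_on_subset[OF DERIV_continuous_on]) (use s in auto)
  have uT: "0 < ?u T"
  proof (rule ccontr)
    assume "\<not> 0 < ?u T"
    then obtain c where "s \<le> c" "c \<le> T" "?u c = 0"
      using IVT2'[of ?u T 0 s] s cont by auto
    then have "(?u s)\<^sup>2 \<le> 0" using diff_square_mono[of s c] s by simp
    then show False using s by simp
  qed
  have "0 \<le> ?u T * (z2 T - z1 T)"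
    using assms by (intro diff_times_deriv_nonneg) auto
  then have "z1 T \<le> z2 T"
    using uT by (simp add: zero_le_mult_iff)
  moreover have "flux \<eta> (y1 T) < flux \<eta> (y2 T)"
    using flux_strict_mono[of \<eta> "y1 T" "y2 T"] uT \<eta> by simp
  ultimately show ?thesis by linarith
qed

end

text \<open>Gronwall: both solutions are bounded on the compact interval, so \<open>force\<close> is
  Lipschitz there with a constant \<open>L\<close>. Then the squared distance in phase space grows
  at rate at most \<open>1 + L\<close>, starting from 0.\<close>

lemma ivp_solution_unique:
  assumes "\<eta> \<ge> 0" and ode1: "solves_ode \<eta> {0..T} y1 z1" and ode2: "solves_ode \<eta> {0..T} y2 z2"
    and init: "y1 0 = y2 0" "z1 0 = z2 0" and t: "t \<in> {0..T}"
  shows "y1 t = y2 t" "z1 t = z2 t"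
proof -
  have bounded: "\<exists>M. \<forall>t\<in>{0..T}. \<bar>y t\<bar> \<le> M" if "solves_ode \<eta> {0..T} y z" for y z
  proof -
    have "continuous_on {0..T} y"
      using solves_odeD(1)[OF that] by (rule DERIV_continuous_on)
    then have "bounded (y ` {0..T})"
      by (intro compact_imp_bounded compact_continuous_image) auto
    then show ?thesis by (auto simp: bounded_iff)
  qed
  obtain M1 M2 where M12: "\<And>t. t \<in> {0..T} \<Longrightarrow> \<bar>y1 t\<bar> \<le> M1" "\<And>t. t \<in> {0..T} \<Longrightarrow> \<bar>y2 t\<bar> \<le> M2"
    using bounded[OF ode1] bounded[OF ode2] by blast
  define M where "M = max M1 M2"
  have M: "\<bar>y1 t\<bar> \<le> M" "\<bar>y2 t\<bar> \<le> M" if "t \<in> {0..T}" for t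
    using M12[OF that] unfolding M_def by auto
  have "0 \<le> M" using M(1)[OF t] by linarith
  define L where "L = \<bar>4 * \<eta>\<^sup>2 - 1\<bar> + 6 * \<eta> * M + 3/2 * M\<^sup>2"
  have L: "0 \<le> L" using \<open>0 \<le> M\<close> assms(1) unfolding L_def by simp
  define u where "u t = y2 t - y1 t" for t
  define w where "w t = z2 t - z1 t" for t
  define k where "k t = force \<eta> (y2 t) - force \<eta> (y1 t)" for t
  \<comment> \<open>The sign turns the decreasing weighted distance into an increasing function. In
    the rate, 1 absorbs \<open>2 * u * w\<close> and \<open>L\<close> absorbs
    \<open>2 * w * k\<close>.\<close>
  let ?E = "\<lambda>t. - (((u t)\<^sup>2 + (w t)\<^sup>2) * exp (- (1 + L) * t))"
  let ?E' = "\<lambda>t. ((1 + L) * ((u t)\<^sup>2 + (w t)\<^sup>2) - 2 * u t * w t - 2 * w t * k t)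
    * exp (- (1 + L) * t)"
  have "?E 0 \<le> ?E t"
  proof (rule deriv_within_nonneg_imp_nondecreasing[of 0 T ?E ?E'])
    fix s assume s: "s \<in> {0..T}"
    have "(u has_real_derivative w s) (at s within {0..T})"
      "(w has_real_derivative k s) (at s within {0..T})"
      unfolding u_def w_def k_def
      by (intro derivative_intros solves_odeD[OF ode1 s] solves_odeD[OF ode2 s])+
    then show "(?E has_real_derivative ?E' s) (at s within {0..T})"
      by (auto intro!: derivative_eq_intros simp: algebra_simps)
    have "\<bar>k s\<bar> \<le> L * \<bar>u s\<bar>"
      unfolding k_def u_def L_def by (intro force_lipschitz M s assms(1))
    then have "\<bar>w s\<bar> * \<bar>k s\<bar> \<le> \<bar>w s\<bar> * (L * \<bar>u s\<bar>)"
      by (intro mult_left_mono) auto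
    then have "w s * k s \<le> L * (\<bar>u s\<bar> * \<bar>w s\<bar>)"
      using abs_ge_self[of "w s * k s"] by (simp add: abs_mult mult.commute mult.left_commute)
    moreover have uw: "2 * (\<bar>u s\<bar> * \<bar>w s\<bar>) \<le> (u s)\<^sup>2 + (w s)\<^sup>2"
      using sum_squares_bound[of "\<bar>u s\<bar>" "\<bar>w s\<bar>"] by simp
    moreover have "L * (2 * (\<bar>u s\<bar> * \<bar>w s\<bar>)) \<le> L * ((u s)\<^sup>2 + (w s)\<^sup>2)"
      by (rule mult_left_mono[OF uw L])
    moreover have "u s * w s \<le> \<bar>u s\<bar> * \<bar>w s\<bar>"
      using abs_ge_self[of "u s * w s"] by (simp add: abs_mult)
    ultimately have "0 \<le> (1 + L) * ((u s)\<^sup>2 + (w s)\<^sup>2) - 2 * u s * w s - 2 * w s * k s"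
      by (simp add: distrib_right)
    then show "0 \<le> ?E' s" by simp
  qed (use t in auto)
  then have "((u t)\<^sup>2 + (w t)\<^sup>2) * exp (- (1 + L) * t) \<le> 0"
    using init by (simp add: u_def w_def)
  then have "(u t)\<^sup>2 + (w t)\<^sup>2 \<le> 0"
    by (simp add: mult_le_0_iff)
  then have "u t = 0 \<and> w t = 0"
    by (simp add: sum_power2_le_zero_iff)
  then show "y1 t = y2 t" "z1 t = z2 t"
    by (auto simp: u_def w_def)
qed

text \<open>Uniqueness makes the description in \<open>y_sol\<close> denote, so that it can be
  replaced by any concrete solution.\<close>

lemma y_sol_eq:
  assumes "\<eta> \<ge> 0" and "solves_ode \<eta> {0..T} y z" "y 0 = 0" "z 0 = v" and t: "t \<in> {0..T}"
  shows "y_sol \<eta> v t = y t"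
  unfolding y_sol_def
proof (rule the_equality)
  have sub: "solves_ode \<eta> {0..t} y z"
    using assms(2) t by (auto elim: solves_ode_subset)
  then show "\<exists>x. solves_ivp \<eta> v {0..t} x \<and> x t = y t"
    using assms(3,4) unfolding solves_ivp_def by blast
  fix a assume "\<exists>x. solves_ivp \<eta> v {0..t} x \<and> x t = a"
  then obtain x z' where "solves_ode \<eta> {0..t} x z'" "x 0 = 0" "z' 0 = v" "x t = a"
    unfolding solves_ivp_def by blast
  then show "a = y t"
    using ivp_solution_unique(1)[OF assms(1) _ sub, of x z' t] assms t by auto
qed

section \<open>The maximal interval of existence and the value of \<open>x_sol\<close>\<close>

lemma existence_ivl_solution:
  assumes "t \<in> existence_ivl \<eta> v"
  obtains y z where "solves_ode \<eta> {0..t} y z" "y 0 = 0" "z 0 = v" "t \<ge> 0"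
  using assms unfolding existence_ivl_def solves_ivp_def by blast

lemma existence_ivl_closed_downward:
  assumes "t \<in> existence_ivl \<eta> v"
  shows "{0..t} \<subseteq> existence_ivl \<eta> v"
proof -
  obtain y z where "solves_ode \<eta> {0..t} y z" "y 0 = 0" "z 0 = v"
    using assms by (rule existence_ivl_solution)
  moreover have "solves_ode \<eta> {0..s} y z" if "s \<le> t" for s
    using \<open>solves_ode \<eta> {0..t} y z\<close> that by (auto elim: solves_ode_subset)
  ultimately show ?thesis
    unfolding existence_ivl_def solves_ivp_def by fastforce
qed

text \<open>\<open>x_sol\<close> differentiates within the whole existence interval, which may
  extend beyond \<open>T\<close> or end there. Since the filter is local, a compact interval
  carrying a single solution can replace it.\<close>

lemma at_within_existence_ivl:
  assumes "T \<in> existence_ivl \<eta> v"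
  obtains t where "t \<in> existence_ivl \<eta> v" "T \<le> t"
    "at T within existence_ivl \<eta> v = at T within {0..t}"
proof (cases "\<exists>t\<in>existence_ivl \<eta> v. T < t")
  case True
  then obtain t where t: "t \<in> existence_ivl \<eta> v" "T < t" by blast
  have "at T within existence_ivl \<eta> v = at T within {0..t}"
    using t existence_ivl_closed_downward[OF t(1)]
    by (intro at_within_nhd[of _ "{..<t}"]) (auto simp: existence_ivl_def)
  with t that show ?thesis by auto
next
  case False
  then have "existence_ivl \<eta> v = {0..T}"
    using existence_ivl_closed_downward[OF assms] by (auto simp: existence_ivl_def not_less)
  with assms that show ?thesis by auto
qed

lemma x_sol_eq:
  assumes "\<eta> \<ge> 0" "T > 0" "T \<in> existence_ivl \<eta> v"
  obtains y z where "solves_ode \<eta> {0..T} y z" "y 0 = 0" "z 0 = v"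
    "x_sol \<eta> v T = flux \<eta> (y T) + z T"
proof -
  obtain t where t: "t \<in> existence_ivl \<eta> v" "T \<le> t"
    and at_eq: "at T within existence_ivl \<eta> v = at T within {0..t}"
    using assms(3) by (rule at_within_existence_ivl)
  from t(1) obtain y z where yz: "solves_ode \<eta> {0..t} y z" "y 0 = 0" "z 0 = v" "t \<ge> 0"
    by (rule existence_ivl_solution)
  have eq: "y_sol \<eta> v s = y s" if "s \<in> {0..t}" for s
    using y_sol_eq[OF assms(1) yz(1-3) that] .
  have T: "T \<in> {0..t}" using t assms by auto
  have "(y_sol \<eta> v has_real_derivative z T) (at T within {0..t})"
    by (rule has_field_derivative_transform_within[OF solves_odeD(1)[OF yz(1) T] zero_less_one T])
      (simp add: eq)
  \<comment> \<open>As \<open>0 < T \<le> t\<close>, the interval is nondegenerate and the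
    derivative within it is unique.\<close>
  moreover have "at T within {0..t} \<noteq> bot"
    using assms t by (simp add: at_within_Icc_at trivial_limit_within islimpt_Icc)
  ultimately have "vector_derivative (y_sol \<eta> v) (at T within {0..t}) = z T"
    by (intro vector_derivative_within)
      (simp_all add: has_real_derivative_iff_has_vector_derivative)
  then have "x_sol \<eta> v T = flux \<eta> (y T) + z T"
    using at_eq eq[OF T] by (simp add: x_sol_def flux_def)
  moreover have "solves_ode \<eta> {0..T} y z"
    using yz(1) t by (auto elim: solves_ode_subset)
  ultimately show ?thesis using that yz by blast
qed

lemma x_sol_strict_mono:
  assumes "\<eta> \<ge> 1/2" "T > 0"
  shows "strict_mono_on {v. {0..T} \<subseteq> existence_ivl \<eta> v} (\<lambda>v. x_sol \<eta> v T)"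
proof (rule strict_mono_onI)
  fix v w :: real
  assume "v \<in> {v. {0..T} \<subseteq> existence_ivl \<eta> v}" "w \<in> {v. {0..T} \<subseteq> existence_ivl \<eta> v}" "v < w"
  then have T: "T \<in> existence_ivl \<eta> v" "T \<in> existence_ivl \<eta> w"
    using assms by auto
  have \<eta>: "\<eta> \<ge> 0" using assms by simp
  obtain y1 z1 where 1: "solves_ode \<eta> {0..T} y1 z1" "y1 0 = 0" "z1 0 = v"
    "x_sol \<eta> v T = flux \<eta> (y1 T) + z1 T"
    by (rule x_sol_eq[OF \<eta> assms(2) T(1)])
  obtain y2 z2 where 2: "solves_ode \<eta> {0..T} y2 z2" "y2 0 = 0" "z2 0 = w"
    "x_sol \<eta> w T = flux \<eta> (y2 T) + z2 T"
    by (rule x_sol_eq[OF \<eta> assms(2) T(2)])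
  show "x_sol \<eta> v T < x_sol \<eta> w T"
    using terminal_value_less[OF assms(1) 1(1) 2(1)] 1 2 assms(2) \<open>v < w\<close> by simp
qed

section \<open>Existence by quadrature\<close>

text \<open>Twice the antiderivative of \<open>force\<close> vanishing at 0. A solution rising from
  0 with speed \<open>v\<close> therefore has speed
  \<open>sqrt (v\<^sup>2 + potential \<eta> s)\<close> at height \<open>s\<close>.\<close>

definition potential :: "real \<Rightarrow> real \<Rightarrow> real" where
  "potential \<eta> s = (flux \<eta> s)\<^sup>2 - s\<^sup>2"

lemma potential_0 [simp]: "potential \<eta> 0 = 0"
  by (simp add: potential_def)

lemma potential_eq: "potential \<eta> s = s\<^sup>2 * ((\<bar>s\<bar> / 2 + 2 * \<eta>)\<^sup>2 - 1)"
proof -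
  have "flux \<eta> s = s * (\<bar>s\<bar> / 2 + 2 * \<eta>)"
    by (simp add: flux_def algebra_simps)
  then show ?thesis
    by (simp add: potential_def power_mult_distrib right_diff_distrib)
qed

lemma has_real_derivative_mult_abs:
  fixes s :: real
  shows "((\<lambda>s. s * \<bar>s\<bar>) has_real_derivative 2 * \<bar>s\<bar>) (at s)"
proof (cases s "0::real" rule: linorder_cases)
  case equal
  \<comment> \<open>Away from 0 the difference quotient at 0 equals
    \<open>\<bar>h\<bar>\<close>.\<close>
  have "((\<lambda>h::real. \<bar>h\<bar>) \<longlongrightarrow> 0) (at 0)"
    using tendsto_rabs[of "\<lambda>h::real. h" 0 "at 0"] by simp
  then have "((\<lambda>h::real. h * \<bar>h\<bar> / h) \<longlongrightarrow> 0) (at 0)"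
    by (rule Lim_transform_eventually) (simp add: eventually_at_filter)
  then show ?thesis
    using equal by (simp add: DERIV_def)
next
  case less
  have "((\<lambda>s. - (s * s)) has_real_derivative 2 * \<bar>s\<bar>) (at s)"
    using less by (auto intro!: derivative_eq_intros)
  then show ?thesis
    by (rule has_field_derivative_transform_within_open[of _ _ _ "{..<0}"]) (use less in auto)
next
  case greater
  have "((\<lambda>s. s * s) has_real_derivative 2 * \<bar>s\<bar>) (at s)"
    using greater by (auto intro!: derivative_eq_intros)
  then show ?thesis
    by (rule has_field_derivative_transform_within_open[of _ _ _ "{0<..}"]) (use greater in auto)
qed

lemma has_real_derivative_potential:
  "(potential \<eta> has_real_derivative 2 * force \<eta> s) (at s)"
proof -
  have "((\<lambda>s. (1/2 * (s * \<bar>s\<bar>) + 2 * \<eta> * s)\<^sup>2 - s\<^sup>2) has_real_derivative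
      2 * (1/2 * (s * \<bar>s\<bar>) + 2 * \<eta> * s) * (\<bar>s\<bar> + 2 * \<eta>) - 2 * s) (at s)"
    by (rule derivative_eq_intros has_real_derivative_mult_abs refl | simp add: field_simps)+
  moreover have "potential \<eta> = (\<lambda>s. (1/2 * (s * \<bar>s\<bar>) + 2 * \<eta> * s)\<^sup>2 - s\<^sup>2)"
    by (simp add: potential_def flux_def fun_eq_iff mult.assoc)
  moreover have "2 * (1/2 * (s * \<bar>s\<bar>) + 2 * \<eta> * s) * (\<bar>s\<bar> + 2 * \<eta>) - 2 * s = 2 * force \<eta> s"
    by (simp add: force_def power2_eq_square power3_eq_cube algebra_simps abs_if)
  ultimately show ?thesis by simp
qed

lemma continuous_on_potential: "continuous_on A (potential \<eta>)"
  using has_real_derivative_potential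
  by (intro DERIV_continuous_on[of _ _ "\<lambda>s. 2 * force \<eta> s"]) (auto intro: has_field_derivative_at_within)

text \<open>All three are read off from \<open>potential_eq\<close>:
  \<open>2 * \<eta> \<ge> 1\<close> makes its second factor nonnegative, and that factor grows with
  \<open>\<bar>s\<bar>\<close>. The upper bound drops the \<open>-1\<close> and freezes the factor
  at \<open>t\<close>.\<close>

lemma
  assumes "\<eta> \<ge> 1/2"
  shows potential_nonneg: "0 \<le> potential \<eta> s"
    and potential_mono: "\<lbrakk>0 \<le> s; s \<le> t\<rbrakk> \<Longrightarrow> potential \<eta> s \<le> potential \<eta> t"
    and potential_le: "\<lbrakk>0 \<le> s; s \<le> t\<rbrakk> \<Longrightarrow> potential \<eta> s \<le> ((t / 2 + 2 * \<eta>) * s)\<^sup>2"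
proof -
  have 1: "0 \<le> (\<bar>s\<bar> / 2 + 2 * \<eta>)\<^sup>2 - 1" for s
    using assms one_le_power[of "\<bar>s\<bar> / 2 + 2 * \<eta>" 2] by simp
  then show "0 \<le> potential \<eta> s"
    by (simp add: potential_eq)
  assume st: "0 \<le> s" "s \<le> t"
  then have 2: "(\<bar>s\<bar> / 2 + 2 * \<eta>)\<^sup>2 \<le> (\<bar>t\<bar> / 2 + 2 * \<eta>)\<^sup>2"
    using assms by (intro power_mono) auto
  then show "potential \<eta> s \<le> potential \<eta> t"
    unfolding potential_eq using st 1[of s] 2
    by (intro mult_mono power_mono) auto
  have "potential \<eta> s \<le> s\<^sup>2 * (\<bar>t\<bar> / 2 + 2 * \<eta>)\<^sup>2"
    unfolding potential_eq using 2 by (intro mult_left_mono) auto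
  then show "potential \<eta> s \<le> ((t / 2 + 2 * \<eta>) * s)\<^sup>2"
    using st by (simp add: power_mult_distrib mult.commute)
qed

text \<open>Separation of variables: the time in which a solution rising from 0 with initial speed
  \<open>v\<close> reaches height \<open>b\<close>.\<close>

definition travel_time :: "real \<Rightarrow> real \<Rightarrow> real \<Rightarrow> real" where
  "travel_time \<eta> v b = integral {0..b} (\<lambda>s. 1 / sqrt (v\<^sup>2 + potential \<eta> s))"

section \<open>Dependence of the travel time on height and initial speed\<close>

lemma continuous_on_inverse_speed:
  assumes "\<eta> \<ge> 1/2" "v > 0"
  shows "continuous_on A (\<lambda>s. 1 / sqrt (v\<^sup>2 + potential \<eta> s))"
proof -
  have "v\<^sup>2 + potential \<eta> s > 0" for s
    using assms potential_nonneg[of \<eta> s] by (simp add: add_pos_nonneg)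
  then show ?thesis
    by (intro continuous_intros continuous_on_potential) (auto simp: less_imp_neq[symmetric])
qed

text \<open>Substituting \<open>s = b * r\<close> fixes the domain of integration, so that
  continuity in \<open>b\<close> becomes continuity of a parameter integral.\<close>

lemma travel_time_rescaled:
  assumes "\<eta> \<ge> 1/2" "v > 0" "b \<ge> 0"
  shows "travel_time \<eta> v b = integral {0..1} (\<lambda>r. b / sqrt (v\<^sup>2 + potential \<eta> (b * r)))"
proof -
  have "((\<lambda>r. b *\<^sub>R (1 / sqrt (v\<^sup>2 + potential \<eta> (b * r)))) has_integral
      integral {b * 0..b * 1} (\<lambda>s. 1 / sqrt (v\<^sup>2 + potential \<eta> s))) {0..1}"
    by (rule has_integral_substitution[where c = 0 and d = b])
      (use assms in \<open>auto intro!: derivative_eq_intros continuous_on_inverse_speed simp: mult_left_le\<close>)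
  then show ?thesis
    by (simp add: travel_time_def integral_unique)
qed

lemma continuous_on_travel_time:
  assumes "\<eta> \<ge> 1/2" and A: "A \<subseteq> {0..}" and v: "continuous_on A v" "\<And>b. b \<in> A \<Longrightarrow> v b > 0"
  shows "continuous_on A (\<lambda>b. travel_time \<eta> (v b) b)"
proof -
  let ?f = "\<lambda>b r. b / sqrt ((v b)\<^sup>2 + potential \<eta> (b * r))"
  have pos: "(v b)\<^sup>2 + potential \<eta> (b * r) \<noteq> 0" if "b \<in> A" for b r
    using v(2)[OF that] potential_nonneg[OF assms(1), of "b * r"]
    by (metis add_pos_nonneg less_irrefl zero_less_power)
  have "continuous_on (A \<times> cbox 0 1) (\<lambda>x. ?f (fst x) (snd x))"
    using pos
    by (intro continuous_intros continuous_on_compose2[OF v(1)]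
        continuous_on_compose2[OF continuous_on_potential[of UNIV]]) auto
  then have "continuous_on A (\<lambda>b. integral (cbox 0 1) (?f b))"
    by (intro integral_continuous_on_param) (simp add: split_beta)
  then show ?thesis
    by (rule continuous_on_eq) (use assms in \<open>auto simp: travel_time_rescaled subset_iff\<close>)
qed

text \<open>Up to height \<open>b\<close> the speed is at most \<open>v + K * s\<close>, whose
  reciprocal integrates to the logarithm. The bound forces arbitrarily long travel times as
  \<open>v\<close> tends to 0 at heights bounded away from 0.\<close>

lemma travel_time_lower_bound:
  assumes "\<eta> \<ge> 1/2" "v > 0" "b \<ge> 0"
  defines "K \<equiv> b / 2 + 2 * \<eta>"
  shows "ln (1 + K * b / v) / K \<le> travel_time \<eta> v b"
proof -
  have K: "K > 0" using assms unfolding K_def by simp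
  have "((\<lambda>s. 1 / (v + K * s)) has_integral ln (v + K * b) / K - ln (v + K * 0) / K) {0..b}"
  proof (rule fundamental_theorem_of_calculus)
    fix s assume "s \<in> {0..b}"
    then have "v + K * s > 0" using K assms by (simp add: add_pos_nonneg)
    then have "((\<lambda>s. ln (v + K * s) / K) has_real_derivative 1 / (v + K * s)) (at s within {0..b})"
      using K by (auto intro!: derivative_eq_intros)
    then show "((\<lambda>s. ln (v + K * s) / K) has_vector_derivative 1 / (v + K * s)) (at s within {0..b})"
      by (simp add: has_real_derivative_iff_has_vector_derivative)
  qed (use assms in auto)
  moreover have "((\<lambda>s. 1 / sqrt (v\<^sup>2 + potential \<eta> s)) has_integral travel_time \<eta> v b) {0..b}"
    unfolding travel_time_def
    by (intro integrable_integral integrable_continuous_real continuous_on_inverse_speed assms)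
  ultimately have "ln (v + K * b) / K - ln (v + K * 0) / K \<le> travel_time \<eta> v b"
  proof (rule has_integral_le)
    fix s assume s: "s \<in> {0..b}"
    have pos: "0 < v\<^sup>2 + potential \<eta> s" "0 < v + K * s"
      using assms(1-3) s K potential_nonneg[of \<eta> s] by (auto intro!: add_pos_nonneg)
    have "sqrt (v\<^sup>2 + potential \<eta> s) \<le> sqrt (v\<^sup>2 + (K * s)\<^sup>2)"
      using potential_le[OF assms(1), of s b] s unfolding K_def by simp
    also have "sqrt (v\<^sup>2 + (K * s)\<^sup>2) \<le> v + K * s"
      using s assms K by (intro sqrt_sum_squares_le_sum) auto
    finally show "1 / (v + K * s) \<le> 1 / sqrt (v\<^sup>2 + potential \<eta> s)"
      using pos by (intro divide_left_mono mult_pos_pos) auto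
  qed
  moreover have "1 + K * b / v = (v + K * b) / v"
    using assms by (simp add: field_simps)
  moreover have "ln ((v + K * b) / v) = ln (v + K * b) - ln v"
    using assms(2,3) K by (intro ln_divide_pos add_pos_nonneg mult_nonneg_nonneg) auto
  ultimately show ?thesis
    by (simp add: diff_divide_distrib)
qed

text \<open>A continuous strictly increasing function on a compact interval has a continuous
  inverse, to which the inverse function rule applies inside the image.\<close>

lemma DERIV_inverse_of_increasing:
  fixes G :: "real \<Rightarrow> real"
  assumes "a < b" and G: "\<And>x. x \<in> {a..b} \<Longrightarrow> (G has_real_derivative G' x) (at x within {a..b})"
    and pos: "\<And>x. x \<in> {a..b} \<Longrightarrow> G' x > 0"
  obtains g where "\<And>x. x \<in> {a..b} \<Longrightarrow> g (G x) = x"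
    and "\<And>t. t \<in> {G a<..<G b} \<Longrightarrow> (g has_real_derivative inverse (G' (g t))) (at t)"
proof -
  have cont: "continuous_on {a..b} G"
    using G by (rule DERIV_continuous_on)
  have mono: "G x < G y" if "x < y" "x \<in> {a..b}" "y \<in> {a..b}" for x y
  proof (rule DERIV_pos_imp_increasing_open[OF \<open>x < y\<close>])
    fix s assume s: "x < s" "s < y"
    then have "at s within {a..b} = at s" "s \<in> {a..b}"
      using that by (auto intro!: at_within_Icc_at)
    then show "\<exists>y. DERIV G s :> y \<and> 0 < y"
      using G[of s] pos[of s] by auto
  qed (rule continuous_on_subset[OF cont], use that in auto)
  have le_mono: "G x \<le> G y" if "x \<le> y" "x \<in> {a..b}" "y \<in> {a..b}" for x y
    using mono[of x y] that by (cases "x = y") auto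
  have inj: "inj_on G {a..b}"
    by (rule linorder_inj_onI) (use mono in \<open>force+\<close>)
  define g where "g = the_inv_into {a..b} G"
  have gG: "g (G x) = x" if "x \<in> {a..b}" for x
    unfolding g_def using inj that by (rule the_inv_into_f_f)
  have preimage: "\<exists>x\<in>{a..b}. G x = t" if "t \<in> {G a..G b}" for t
    using IVT'[of G a t b] cont that \<open>a < b\<close> by auto
  have "G ` {a..b} = {G a..G b}"
    using preimage le_mono \<open>a < b\<close> by (fastforce simp: image_iff)
  then have g_cont: "continuous_on {G a..G b} g"
    using continuous_on_inv[OF cont, of g] gG by auto
  have "(g has_real_derivative inverse (G' (g t))) (at t)" if t: "t \<in> {G a<..<G b}" for t
  proof (rule DERIV_inverse_function)
    obtain x where x: "x \<in> {a..b}" "G x = t"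
      using preimage[of t] t by auto
    then have "x \<noteq> a" "x \<noteq> b" using t by auto
    then have "at x within {a..b} = at x"
      using x by (intro at_within_Icc_at) auto
    then show "DERIV G (g t) :> G' (g t)" "G' (g t) \<noteq> 0"
      using G[OF x(1)] pos[OF x(1)] gG[OF x(1)] x(2) by auto
    show "G a < t" "t < G b" using t by auto
    show "G (g s) = s" if "G a < s" "s < G b" for s
      using preimage[of s] that gG by auto
    show "isCont g t"
      using continuous_on_interior[OF g_cont, of t] t by simp
  qed
  with gG that show ?thesis by blast
qed

text \<open>The inverse of the travel time, as a function of height, satisfies the first-order
  energy equation; differentiating that equation recovers the second-order one.\<close>

lemma solution_of_travel_time:
  assumes "\<eta> \<ge> 1/2" "v > 0" "b > 0" and T: "T = travel_time \<eta> v b"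
  obtains y z where "solves_ode \<eta> {0..T} y z" "y 0 = 0" "y T = b" "z T = sqrt (v\<^sup>2 + potential \<eta> b)"
proof -
  let ?w = "\<lambda>s. sqrt (v\<^sup>2 + potential \<eta> s)"
  have w: "v\<^sup>2 + potential \<eta> s > 0" for s
    using assms potential_nonneg[of \<eta> s] by (simp add: add_pos_nonneg)
  \<comment> \<open>The margin of 1 on both sides puts 0 and \<open>T\<close> inside the open image
    interval, so the inverse is differentiable on all of \<open>{0..T}\<close>.\<close>
  obtain F where F: "\<And>s. s \<in> {-1..b + 1} \<Longrightarrow>
      (F has_vector_derivative 1 / ?w s) (at s within {-1..b + 1})"
    by (rule antiderivative_continuous[OF continuous_on_inverse_speed[OF assms(1,2)],
          of "-1" "b + 1"]) blast
  define G where "G s = F s - F 0" for s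
  have G: "(G has_real_derivative 1 / ?w s) (at s within {-1..b + 1})" if "s \<in> {-1..b + 1}" for s
  proof -
    have "(F has_real_derivative 1 / ?w s) (at s within {-1..b + 1})"
      using F[OF that] by (simp add: has_real_derivative_iff_has_vector_derivative)
    then show ?thesis
      unfolding G_def by (auto intro!: derivative_eq_intros)
  qed
  have "((\<lambda>s. 1 / ?w s) has_integral G b - G 0) {0..b}"
  proof (rule fundamental_theorem_of_calculus)
    fix s assume "s \<in> {0..b}"
    then have "(G has_real_derivative 1 / ?w s) (at s within {0..b})"
      by (intro DERIV_subset[OF G]) auto
    then show "(G has_vector_derivative 1 / ?w s) (at s within {0..b})"
      by (simp add: has_real_derivative_iff_has_vector_derivative)
  qed (use assms in auto)
  then have Gb: "G b = T" "G 0 = 0"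
    by (simp_all add: T travel_time_def integral_unique G_def)
  obtain g where gG: "\<And>s. s \<in> {-1..b + 1} \<Longrightarrow> g (G s) = s"
    and g: "\<And>t. t \<in> {G (-1)<..<G (b + 1)} \<Longrightarrow> (g has_real_derivative inverse (1 / ?w (g t))) (at t)"
    by (rule DERIV_inverse_of_increasing[of "-1" "b + 1" G "\<lambda>s. 1 / ?w s"])
      (use G w assms in auto)
  have less: "G s < G t" if "s < t" "-1 \<le> s" "t \<le> b + 1" for s t
  proof -
    have "G s \<le> G t"
      by (rule deriv_within_nonneg_imp_nondecreasing[of "-1" "b + 1" G, OF G])
        (use that w in \<open>auto intro: less_imp_le\<close>)
    moreover have "G s \<noteq> G t"
      using gG[of s] gG[of t] that by auto
    ultimately show ?thesis by simp
  qed
  have "G (-1) < 0" "T < G (b + 1)"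
    using less[of "-1" 0] less[of b "b + 1"] Gb assms by auto
  then have dg: "(g has_real_derivative ?w (g t)) (at t)" if "t \<in> {0..T}" for t
    using g[of t] that by simp
  show ?thesis
  proof (rule that)
    show "solves_ode \<eta> {0..T} g (\<lambda>t. ?w (g t))"
    proof (rule solves_odeI)
      fix t assume t: "t \<in> {0..T}"
      show "(g has_real_derivative ?w (g t)) (at t within {0..T})"
        using dg[OF t] by (rule has_field_derivative_at_within)
      have "((\<lambda>t. potential \<eta> (g t)) has_real_derivative 2 * force \<eta> (g t) * ?w (g t)) (at t)"
        by (rule DERIV_chain2[OF has_real_derivative_potential dg[OF t]])
      then have "((\<lambda>t. ?w (g t)) has_real_derivative force \<eta> (g t)) (at t)"
        using w[of "g t"] by (auto intro!: derivative_eq_intros simp: field_simps)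
      then show "((\<lambda>t. ?w (g t)) has_real_derivative force \<eta> (g t)) (at t within {0..T})"
        by (rule has_field_derivative_at_within)
    qed
    show "g 0 = 0" "g T = b" "?w (g T) = ?w b"
      using gG[of 0] gG[of b] Gb assms by auto
  qed
qed

text \<open>For a terminal height \<open>b\<close> the boundary condition \<open>flux \<eta> b + sqrt (v\<^sup>2 + potential \<eta> b) = a\<close>
  fixes the initial speed \<open>v b\<close>. It vanishes at some \<open>c\<close>, and the travel time to \<open>b\<close> goes from \<open>0\<close>
  to infinity as \<open>b\<close> runs through \<open>[0, c)\<close>.\<close>

lemma bvp_solution_exists_pos:
  assumes "\<eta> \<ge> 1/2" "T > 0" "a > 0"
  shows "\<exists>y z. solves_ode \<eta> {0..T} y z \<and> y 0 = 0 \<and> flux \<eta> (y T) + z T = a"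
proof -
  let ?P = "potential \<eta>"
  \<comment> \<open>The boundary value at terminal height \<open>b\<close> when the initial speed is
    0; the \<open>c\<close> sought solves \<open>S c = a\<close>.\<close>
  define S where "S b = flux \<eta> b + sqrt (?P b)" for b
  have contS: "continuous_on A S" for A
    unfolding S_def by (intro continuous_intros continuous_on_flux continuous_on_potential)
  have "0 \<le> a / 2 * \<bar>a\<bar>" "a \<le> 2 * \<eta> * a"
    using assms by (auto simp: mult_le_cancel_right1)
  then have "a \<le> flux \<eta> a" by (simp add: flux_def)
  then have "a \<le> S a"
    using potential_nonneg[OF assms(1), of a] unfolding S_def by (simp add: add_increasing2)
  moreover have "S 0 = 0" by (simp add: S_def)
  ultimately obtain c where c: "0 \<le> c" "c \<le> a" "S c = a"
    using IVT'[of S 0 a a] contS assms by auto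
  then have "c > 0" using \<open>S 0 = 0\<close> assms by (cases "c = 0") auto
  have flux_less: "flux \<eta> b + sqrt (?P b) < a" if "0 \<le> b" "b < c" for b
  proof -
    have "flux \<eta> b + sqrt (?P b) < flux \<eta> c + sqrt (?P c)"
      using that assms(1) by (intro add_less_le_mono flux_strict_mono real_sqrt_le_mono potential_mono) auto
    then show ?thesis using c(3) by (simp add: S_def)
  qed
  \<comment> \<open>The boundary condition solved for the initial speed; \<open>flux_less\<close>
    ensures that the radicand is positive below \<open>c\<close>.\<close>
  define v where "v b = sqrt ((a - flux \<eta> b)\<^sup>2 - ?P b)" for b
  have contv: "continuous_on A v" for A
    unfolding v_def by (intro continuous_intros continuous_on_flux continuous_on_potential)
  have v_pos: "(a - flux \<eta> b)\<^sup>2 - ?P b > 0" if "0 \<le> b" "b < c" for b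
  proof -
    have "(sqrt (?P b))\<^sup>2 < (a - flux \<eta> b)\<^sup>2"
      using flux_less[OF that] potential_nonneg[OF assms(1), of b]
      by (intro power_strict_mono) auto
    then show ?thesis
      using potential_nonneg[OF assms(1), of b] by simp
  qed
  have vc: "v c = 0"
    using c(3) potential_nonneg[OF assms(1), of c] unfolding v_def S_def
    by (metis add_diff_cancel_left' diff_self real_sqrt_pow2 real_sqrt_zero)
  \<comment> \<open>If \<open>v m < \<epsilon>\<close> and \<open>c / 2 \<le> m < c\<close>, then
    \<open>?K * m / v m\<close> is at least \<open>\<eta> * c / \<epsilon>\<close>, which is the
    exponential here; the logarithmic lower bound then gives travel time at least
    \<open>T\<close>.\<close>
  define \<epsilon> where "\<epsilon> = \<eta> * c / exp ((c / 2 + 2 * \<eta>) * T)"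
  have "\<epsilon> > 0" using assms \<open>c > 0\<close> unfolding \<epsilon>_def by simp
  moreover have "continuous_on {0..c} v" by (rule contv)
  ultimately obtain d where d: "d > 0" "\<And>b. b \<in> {0..c} \<Longrightarrow> dist b c < d \<Longrightarrow> dist (v b) (v c) < \<epsilon>"
    using \<open>c > 0\<close> unfolding continuous_on_iff by (metis atLeastAtMost_iff less_imp_le order_refl)
  \<comment> \<open>Close enough to \<open>c\<close> for \<open>v m < \<epsilon>\<close>, yet at
    least \<open>c / 2\<close> and strictly below \<open>c\<close>, so that \<open>v\<close> stays
    positive on \<open>{0..m}\<close>.\<close>
  define m where "m = max (c / 2) (c - d / 2)"
  have m: "c / 2 \<le> m" "m < c" "0 < m"
    using \<open>c > 0\<close> d(1) unfolding m_def by auto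
  have "dist m c < d"
    using \<open>c > 0\<close> d(1) unfolding m_def dist_real_def by (auto simp: max_def)
  then have "\<bar>v m\<bar> < \<epsilon>"
    using d(2)[of m] m vc by simp
  moreover have vm: "v m > 0"
    using v_pos[of m] m by (simp add: v_def)
  ultimately have "v m < \<epsilon>" by simp
  let ?K = "m / 2 + 2 * \<eta>"
  have K: "?K > 0" "?K \<le> c / 2 + 2 * \<eta>" using m assms by auto
  have "T \<le> travel_time \<eta> (v m) m"
  proof -
    have "exp (?K * T) \<le> exp ((c / 2 + 2 * \<eta>) * T)"
      using K assms by simp
    also have "\<dots> = \<eta> * c / \<epsilon>"
      using assms \<open>c > 0\<close> unfolding \<epsilon>_def by simp
    also have "\<dots> \<le> ?K * m / v m"
    proof (rule frac_le)
      have "2 * \<eta> * (c / 2) \<le> ?K * m"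
        using m assms by (intro mult_mono) auto
      then show "\<eta> * c \<le> ?K * m" by simp
    qed (use vm \<open>v m < \<epsilon>\<close> K m in auto)
    also have "\<dots> \<le> 1 + ?K * m / v m" by simp
    finally have "?K * T \<le> ln (1 + ?K * m / v m)"
      by (subst ln_ge_iff) (use vm K m in \<open>auto intro!: add_pos_nonneg\<close>)
    then have "T \<le> ln (1 + ?K * m / v m) / ?K"
      using K by (simp add: pos_le_divide_eq mult.commute)
    also have "\<dots> \<le> travel_time \<eta> (v m) m"
      using assms vm m by (intro travel_time_lower_bound) auto
    finally show ?thesis .
  qed
  moreover have "travel_time \<eta> (v 0) 0 \<le> T"
    using assms by (simp add: travel_time_def)
  moreover have "continuous_on {0..m} (\<lambda>b. travel_time \<eta> (v b) b)"
    using assms(1) _ contv by (rule continuous_on_travel_time) (use v_pos m in \<open>auto simp: v_def\<close>)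
  ultimately obtain b where b: "0 \<le> b" "b \<le> m" "travel_time \<eta> (v b) b = T"
    using IVT'[of "\<lambda>b. travel_time \<eta> (v b) b" 0 T m] m by auto
  then have "b > 0"
    using assms(2) by (cases "b = 0") (auto simp: travel_time_def)
  have sq: "(a - flux \<eta> b)\<^sup>2 - ?P b > 0" and "flux \<eta> b + sqrt (?P b) < a"
    using v_pos[of b] flux_less[of b] b m by auto
  then have "flux \<eta> b < a"
    using potential_nonneg[OF assms(1), of b] by (smt (verit) real_sqrt_ge_zero)
  then have vb: "v b > 0" "sqrt ((v b)\<^sup>2 + ?P b) = a - flux \<eta> b"
    using sq by (simp_all add: v_def)
  obtain y z where "solves_ode \<eta> {0..T} y z" "y 0 = 0" "y T = b"
    "z T = sqrt ((v b)\<^sup>2 + ?P b)"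
    by (rule solution_of_travel_time[OF assms(1) vb(1) \<open>b > 0\<close> b(3)[symmetric]])
  with vb(2) show ?thesis by fastforce
qed

text \<open>The equation and the boundary operator are odd, so negative data reduce to positive
  data; zero data admit the zero solution.\<close>

lemma bvp_solution_exists:
  assumes "\<eta> \<ge> 1/2" "T > 0"
  shows "\<exists>y z. solves_ode \<eta> {0..T} y z \<and> y 0 = 0 \<and> flux \<eta> (y T) + z T = a"
proof -
  consider "a > 0" | "a = 0" | "- a > 0" by linarith
  then show ?thesis
  proof cases
    case 1
    with assms show ?thesis by (intro bvp_solution_exists_pos)
  next
    case 2
    have "solves_ode \<eta> {0..T} (\<lambda>_. 0) (\<lambda>_. 0)"
      by (rule solves_odeI) (auto simp: force_def)
    with 2 show ?thesis by fastforce
  next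
    case 3
    obtain y z where "solves_ode \<eta> {0..T} y z" "y 0 = 0" "flux \<eta> (y T) + z T = - a"
      using bvp_solution_exists_pos[OF assms 3] by blast
    with solves_ode_minus[of \<eta> "{0..T}" y z] show ?thesis
      by (intro exI[of _ "\<lambda>t. - y t"] exI[of _ "\<lambda>t. - z t"]) auto
  qed
qed

section \<open>The boundary value problem for functions on \<open>{0..T}\<close>\<close>

lemma solves_bvp_iff:
  "solves_bvp \<eta> T \<theta> y \<longleftrightarrow>
     (\<exists>z. solves_ode \<eta> {0..T} y z \<and> y 0 = 0 \<and> flux \<eta> (y T) + z T = 2 * \<theta> - 1)"
  unfolding solves_bvp_def flux_def by blast

theorem proposition3p1:
  fixes \<eta> T :: real
  assumes "\<eta> \<ge> 1/2" and "T > 0"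
  shows "strict_mono_on {v. {0..T} \<subseteq> existence_ivl \<eta> v} (\<lambda>v. x_sol \<eta> v T) \<and>
         (\<forall>\<theta>\<in>{0..1}. \<exists>!y. y \<in> {0..T} \<rightarrow>\<^sub>E UNIV \<and> solves_bvp \<eta> T \<theta> y)"
proof (intro conjI ballI ex_ex1I)
  show "strict_mono_on {v. {0..T} \<subseteq> existence_ivl \<eta> v} (\<lambda>v. x_sol \<eta> v T)"
    using assms by (rule x_sol_strict_mono)
next
  fix \<theta> :: real
  obtain y z where yz: "solves_ode \<eta> {0..T} y z" "y 0 = 0" "flux \<eta> (y T) + z T = 2 * \<theta> - 1"
    using bvp_solution_exists[OF assms] by blast
  \<comment> \<open>Restriction selects the extensional representative, which fixes the values
    outside \<open>{0..T}\<close>.\<close>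
  have "solves_ode \<eta> {0..T} (restrict y {0..T}) z"
    using yz(1) by (rule solves_ode_cong) simp
  then have "solves_bvp \<eta> T \<theta> (restrict y {0..T})"
    unfolding solves_bvp_iff using yz assms by auto
  then show "\<exists>y. y \<in> {0..T} \<rightarrow>\<^sub>E UNIV \<and> solves_bvp \<eta> T \<theta> y"
    by (intro exI[of _ "restrict y {0..T}"]) auto
next
  fix \<theta> :: real and y1 y2
  assume 1: "y1 \<in> {0..T} \<rightarrow>\<^sub>E UNIV \<and> solves_bvp \<eta> T \<theta> y1"
    and 2: "y2 \<in> {0..T} \<rightarrow>\<^sub>E UNIV \<and> solves_bvp \<eta> T \<theta> y2"
  then obtain z1 z2 where
    "solves_ode \<eta> {0..T} y1 z1" "y1 0 = 0" "flux \<eta> (y1 T) + z1 T = 2 * \<theta> - 1"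
    "solves_ode \<eta> {0..T} y2 z2" "y2 0 = 0" "flux \<eta> (y2 T) + z2 T = 2 * \<theta> - 1"
    unfolding solves_bvp_iff by blast
  then have "y1 t = y2 t" if "t \<in> {0..T}" for t
    using bvp_solution_unique[OF assms(1), of T y1 z1 y2 z2 t] that by simp
  with 1 2 show "y1 = y2"
    by (intro PiE_ext[of y1 "{0..T}" _ y2]) auto
qed

end
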